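(* There is a rearrangement-invariant quasi-Banach function norm over $M((0,\infty),\lambda)$ which has the property (P5) and for which the Hardy--Littlewood--Pólya principle does not hold.
   Context: $\lambda$ is Lebesgue measure on $(0,\infty)$; $M=M((0,\infty),\lambda)$ is the set of extended complex-valued measurable functions (identified when equal a.e.), $M_+$ the non-negative ones. The non-increasing rearrangement of $f\in M$ is $f^*(t)=\inf\{s\ge 0:\lambda(\{|f|>s\})\le t\}$. A quasi-Banach function norm is a map $\lVert\cdot\rVert:M\to[0,\infty]$ with $\lVert\,|f|\,\rVert=\lVert f\rVert$ whose restriction to $M_+$ satisfies: (Q1) it is positively homogeneous, $\lVert f\rVert=0\Leftrightarrow f=0$ a.e., and there is a constant $C\ge1$ with $\lVert f+g\rVert\le C(\lVert f\rVert+\lVert g\rVert)$; (P2) $f\le g$ a.e. implies $\lVert f\rVert\le\lVert g\rVert$; (P3) $f_n\uparrow f$ a.e. implies $\lVert f_n\rVert\uparrow\lVert f\rVert$; (P4) $\lVert\chi_E\rVert<\infty$ whenever $\lambda(E)<\infty$. Property (P5): for every $E$ with $\lambda(E)<\infty$ there is a finite $C_E$ with $\int_E f\,d\lambda\le C_E\lVert f\rVert$ for all $f\in M_+$. The norm is rearrangement-invariant if $f^*=g^*$ implies $\lVert f\rVert=\lVert g\rVert$. The Hardy--Littlewood--Pólya principle holds for $\lVert\cdot\rVert$ if $\lVert f\rVert\le\lVert g\rVert$ for every pair $f,g\in M$ satisfying $\int_0^tf^*\,d\lambda\le\int_0^tg^*\,d\lambda$ for all $t\in(0,\infty)$. *)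

theory Defs
  imports "HOL-Analysis.Analysis"
begin

section \<open>Extended complex-valued measurable functions on the half-line\<close>

text \<open>The extended complex numbers are the one-point compactification of the plane, with
  \<^term>\<open>None\<close> as the point at infinity.\<close>

type_synonym ecomplex = "complex option"

definition borel_ecomplex :: "ecomplex measure" where
  "borel_ecomplex =
     sigma UNIV {U. openin (Alexandroff_compactification (euclidean :: complex topology)) U}"

definition emod :: "ecomplex \<Rightarrow> ennreal" where
  "emod z = (case z of None \<Rightarrow> \<infinity> | Some w \<Rightarrow> ennreal (cmod w))"

definition ecomplex_of_ennreal :: "ennreal \<Rightarrow> ecomplex" where
  "ecomplex_of_ennreal a =
     (if a = \<infinity> then None else Some (complex_of_real (enn2real a)))"

abbreviation leb_pos :: "real measure" where
  "leb_pos \<equiv> lebesgue_on {0<..}"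

text \<open>Functions are total on the reals, but only their values on the positive half-line matter:
  measurability and almost-everywhere statements for \<^term>\<open>leb_pos\<close> ignore all other points.\<close>

definition Mfun :: "(real \<Rightarrow> ecomplex) set" where
  "Mfun = measurable leb_pos borel_ecomplex"

text \<open>The non-negative functions in \<^term>\<open>Mfun\<close> are represented by measurable
  \<^typ>\<open>ennreal\<close>-valued functions (see \<open>nonneg_Mfun_eq\<close> below), so that addition,
  order and integration on them are those of \<^typ>\<open>ennreal\<close>.\<close>

definition Mplus :: "(real \<Rightarrow> ennreal) set" where
  "Mplus = borel_measurable leb_pos"

definition lift_fun :: "(real \<Rightarrow> ennreal) \<Rightarrow> real \<Rightarrow> ecomplex" where
  "lift_fun u = (\<lambda>x. ecomplex_of_ennreal (u x))"

definition abs_fun :: "(real \<Rightarrow> ecomplex) \<Rightarrow> real \<Rightarrow> ennreal" where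
  "abs_fun f = (\<lambda>x. emod (f x))"

lemma emod_ecomplex_of_ennreal [simp]: "emod (ecomplex_of_ennreal a) = a"
  by (cases a) (auto simp: emod_def ecomplex_of_ennreal_def)

lemma abs_lift_fun [simp]: "abs_fun (lift_fun u) = u"
  by (simp add: abs_fun_def lift_fun_def)

lemma space_borel_ecomplex [simp]: "space borel_ecomplex = UNIV"
  by (simp add: borel_ecomplex_def space_measure_of_conv)

lemma sets_borel_ecomplex_open:
  "openin (Alexandroff_compactification (euclidean :: complex topology)) U
     \<Longrightarrow> U \<in> sets borel_ecomplex"
  by (simp add: borel_ecomplex_def sets_measure_of)

lemma measurable_emod [measurable]: "emod \<in> borel_measurable borel_ecomplex"
proof (rule borel_measurableI_greater)
  fix a :: ennreal
  have "openin (Alexandroff_compactification (euclidean :: complex topology)) {z. a < emod z}"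
  proof (cases a)
    case (real r)
    have "{z. a < emod z} = insert None (Some ` (topspace euclidean - cball 0 r))"
    proof (rule set_eqI)
      fix z :: ecomplex
      show "z \<in> {z. a < emod z} \<longleftrightarrow>
          z \<in> insert None (Some ` (topspace euclidean - cball 0 r))"
        using real by (cases z) (auto simp: emod_def ennreal_less_iff image_iff)
    qed
    moreover have "compactin euclidean (cball (0::complex) r)"
      and "closedin euclidean (cball (0::complex) r)"
      by simp_all
    ultimately show ?thesis
      unfolding openin_Alexandroff_compactification by blast
  next
    case top
    then show ?thesis by simp
  qed
  then show "{z \<in> space borel_ecomplex. a < emod z} \<in> sets borel_ecomplex"
    by (simp add: sets_borel_ecomplex_open)
qed

lemma measurable_Some_ecomplex [measurable]: "Some \<in> measurable borel borel_ecomplex"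
  unfolding borel_ecomplex_def
proof (rule measurable_measure_of)
  fix U :: "ecomplex set"
  assume "U \<in> {U. openin (Alexandroff_compactification (euclidean :: complex topology)) U}"
  then consider V where "open V" "U = Some ` V"
    | C where "closed C" "U = insert None (Some ` (- C))"
    by (auto simp: openin_Alexandroff_compactification Compl_eq_Diff_UNIV)
  then show "Some -` U \<inter> space borel \<in> sets borel"
  proof cases
    case 1
    then have "Some -` U = V" by auto
    with 1 show ?thesis by simp
  next
    case 2
    then have "Some -` U = - C" by auto
    with 2 show ?thesis by simp
  qed
qed auto

lemma measurable_ecomplex_of_ennreal [measurable]:
  "ecomplex_of_ennreal \<in> measurable borel borel_ecomplex"
  unfolding ecomplex_of_ennreal_def by measurable

lemma abs_fun_Mplus: "f \<in> Mfun \<Longrightarrow> abs_fun f \<in> Mplus"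
  unfolding Mfun_def Mplus_def abs_fun_def by measurable

lemma lift_fun_Mfun_iff: "lift_fun u \<in> Mfun \<longleftrightarrow> u \<in> Mplus"
proof
  assume "lift_fun u \<in> Mfun"
  then show "u \<in> Mplus" using abs_fun_Mplus by fastforce
next
  assume "u \<in> Mplus"
  then show "lift_fun u \<in> Mfun"
    unfolding Mfun_def Mplus_def lift_fun_def by measurable
qed

lemma nonneg_Mfun_eq:
  "lift_fun ` Mplus =
     {f \<in> Mfun. \<forall>x. f x = None \<or> (\<exists>r\<ge>0. f x = Some (complex_of_real r))}"
proof (intro equalityI subsetI)
  fix f assume "f \<in> lift_fun ` Mplus"
  then show "f \<in> {f \<in> Mfun. \<forall>x. f x = None \<or> (\<exists>r\<ge>0. f x = Some (complex_of_real r))}"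
    by (auto simp: lift_fun_Mfun_iff)
      (metis ecomplex_of_ennreal_def enn2real_nonneg lift_fun_def)
next
  fix f
  assume f: "f \<in> {f \<in> Mfun. \<forall>x. f x = None \<or> (\<exists>r\<ge>0. f x = Some (complex_of_real r))}"
  have "lift_fun (abs_fun f) = f"
  proof
    fix x
    from f have "f x = None \<or> (\<exists>r\<ge>0. f x = Some (complex_of_real r))" by simp
    then show "lift_fun (abs_fun f) x = f x"
      by (auto simp: lift_fun_def abs_fun_def ecomplex_of_ennreal_def emod_def)
  qed
  with f show "f \<in> lift_fun ` Mplus"
    by (metis (no_types, lifting) abs_fun_Mplus image_eqI mem_Collect_eq)
qed


section \<open>Non-increasing rearrangement\<close>

definition rearrangement :: "(real \<Rightarrow> ecomplex) \<Rightarrow> real \<Rightarrow> ennreal" where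
  "rearrangement f t =
     Inf (ennreal ` {s. 0 \<le> s \<and>
       emeasure leb_pos {x \<in> space leb_pos. ennreal s < emod (f x)} \<le> ennreal t})"


section \<open>Quasi-Banach function norms\<close>

text \<open>Functionals are only constrained on \<^term>\<open>Mfun\<close>. The first clause of
  \<open>quasi_Banach_function_norm\<close> says that the functional is well defined on classes of functions
  equal almost everywhere.\<close>

type_synonym fnorm = "(real \<Rightarrow> ecomplex) \<Rightarrow> ennreal"

definition axiom_Q1 :: "fnorm \<Rightarrow> bool" where
  "axiom_Q1 N \<longleftrightarrow>
     (\<forall>a\<ge>0. \<forall>u\<in>Mplus. N (lift_fun (\<lambda>x. ennreal a * u x)) = ennreal a * N (lift_fun u)) \<and>
     (\<forall>u\<in>Mplus. N (lift_fun u) = 0 \<longleftrightarrow> (AE x in leb_pos. u x = 0)) \<and>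
     (\<exists>C\<ge>1. \<forall>u\<in>Mplus. \<forall>v\<in>Mplus.
        N (lift_fun (\<lambda>x. u x + v x)) \<le> ennreal C * (N (lift_fun u) + N (lift_fun v)))"

definition axiom_P2 :: "fnorm \<Rightarrow> bool" where
  "axiom_P2 N \<longleftrightarrow>
     (\<forall>u\<in>Mplus. \<forall>v\<in>Mplus. (AE x in leb_pos. u x \<le> v x) \<longrightarrow> N (lift_fun u) \<le> N (lift_fun v))"

definition axiom_P3 :: "fnorm \<Rightarrow> bool" where
  "axiom_P3 N \<longleftrightarrow>
     (\<forall>U u. (\<forall>n. U n \<in> Mplus) \<and> u \<in> Mplus \<and>
        (AE x in leb_pos. incseq (\<lambda>n. U n x) \<and> (\<lambda>n. U n x) \<longlonglongrightarrow> u x)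
        \<longrightarrow> incseq (\<lambda>n. N (lift_fun (U n))) \<and> (\<lambda>n. N (lift_fun (U n))) \<longlonglongrightarrow> N (lift_fun u))"

definition axiom_P4 :: "fnorm \<Rightarrow> bool" where
  "axiom_P4 N \<longleftrightarrow>
     (\<forall>E\<in>sets leb_pos. emeasure leb_pos E < \<infinity> \<longrightarrow> N (lift_fun (indicator E)) < \<infinity>)"

definition axiom_P5 :: "fnorm \<Rightarrow> bool" where
  "axiom_P5 N \<longleftrightarrow>
     (\<forall>E\<in>sets leb_pos. emeasure leb_pos E < \<infinity> \<longrightarrow>
        (\<exists>C<\<infinity>. \<forall>u\<in>Mplus. (\<integral>\<^sup>+x\<in>E. u x \<partial>leb_pos) \<le> C * N (lift_fun u)))"

definition quasi_Banach_function_norm :: "fnorm \<Rightarrow> bool" where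
  "quasi_Banach_function_norm N \<longleftrightarrow>
     (\<forall>f\<in>Mfun. \<forall>g\<in>Mfun. (AE x in leb_pos. f x = g x) \<longrightarrow> N f = N g) \<and>
     (\<forall>f\<in>Mfun. N (lift_fun (abs_fun f)) = N f) \<and>
     axiom_Q1 N \<and> axiom_P2 N \<and> axiom_P3 N \<and> axiom_P4 N"

definition rearrangement_invariant :: "fnorm \<Rightarrow> bool" where
  "rearrangement_invariant N \<longleftrightarrow>
     (\<forall>f\<in>Mfun. \<forall>g\<in>Mfun. (\<forall>t>0. rearrangement f t = rearrangement g t) \<longrightarrow> N f = N g)"

definition HLP_principle :: "fnorm \<Rightarrow> bool" where
  "HLP_principle N \<longleftrightarrow>
     (\<forall>f\<in>Mfun. \<forall>g\<in>Mfun.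
        (\<forall>t>0. (\<integral>\<^sup>+s\<in>{0<..<t}. rearrangement f s \<partial>leb_pos)
             \<le> (\<integral>\<^sup>+s\<in>{0<..<t}. rearrangement g s \<partial>leb_pos))
        \<longrightarrow> N f \<le> N g)"

end

theory Submission
  imports Defs
begin

text \<open>The witness is the sum of the norm of $L^1$ and the quasi-norm
  $\sup_{s>0} s\,\lambda(\{|f|>s\})^2$ of weak $L^{1/2}$. The $L^1$ summand gives (P5). On the
  function $c\,\chi_{(0,a)}$ the sum takes the value $ca + ca^2$, so it increases from $2$ to $3$
  when $\chi_{(0,1)}$ is spread out to $\frac12\chi_{(0,2)}$, although spreading decreases the
  integrals of the rearrangement. Both summands depend only on the distribution function (for the
  $L^1$ norm by the layer cake formula), hence only on the rearrangement.\<close>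

section \<open>Distribution functions and the quasi-norm built from them\<close>

definition distribution :: "'a measure \<Rightarrow> ('a \<Rightarrow> ennreal) \<Rightarrow> real \<Rightarrow> ennreal" where
  "distribution M u s = emeasure M {x \<in> space M. ennreal s < u x}"

definition weak_half_norm :: "'a measure \<Rightarrow> ('a \<Rightarrow> ennreal) \<Rightarrow> ennreal" where
  "weak_half_norm M u = (SUP s\<in>{0<..}. ennreal s * (distribution M u s)\<^sup>2)"

definition half_norm :: "'a measure \<Rightarrow> ('a \<Rightarrow> ennreal) \<Rightarrow> ennreal" where
  "half_norm M u = (\<integral>\<^sup>+x. u x \<partial>M) + weak_half_norm M u"

text \<open>Writing the measure of a superlevel set as an integral makes monotone convergence and
  the exchange of integrals available for \<open>distribution\<close>.\<close>

lemma distribution_eq_nn_integral: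
  assumes [measurable]: "u \<in> borel_measurable M"
  shows "distribution M u s = (\<integral>\<^sup>+x. indicator {ennreal s<..} (u x) \<partial>M)"
proof -
  have "(\<integral>\<^sup>+x. indicator {ennreal s<..} (u x) \<partial>M)
      = (\<integral>\<^sup>+x. indicator {x \<in> space M. ennreal s < u x} x \<partial>M)"
    by (intro nn_integral_cong) (auto split: split_indicator)
  then show ?thesis by (simp add: distribution_def)
qed

lemma distribution_mono_AE:
  assumes [measurable]: "u \<in> borel_measurable M" "v \<in> borel_measurable M"
    and "AE x in M. u x \<le> v x"
  shows "distribution M u s \<le> distribution M v s"
  unfolding distribution_def
  by (rule emeasure_mono_AE) (use assms(3) in \<open>auto elim!: eventually_mono\<close>)

lemma distribution_antimono:
  assumes [measurable]: "u \<in> borel_measurable M" and "s \<le> t"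
  shows "distribution M u t \<le> distribution M u s"
  unfolding distribution_def
proof (rule emeasure_mono)
  show "{x \<in> space M. ennreal t < u x} \<subseteq> {x \<in> space M. ennreal s < u x}"
    using ennreal_leI[OF \<open>s \<le> t\<close>] by (auto intro: le_less_trans)
qed measurable

text \<open>If neither \<open>u x\<close> nor \<open>v x\<close> exceeds s/2, their sum cannot
  exceed s. Halving the level contributes a factor 2 to the constant in the quasi-triangle
  inequality.\<close>

lemma distribution_add_le:
  assumes [measurable]: "u \<in> borel_measurable M" "v \<in> borel_measurable M" and "0 \<le> s"
  shows "distribution M (\<lambda>x. u x + v x) s
    \<le> distribution M u (s / 2) + distribution M v (s / 2)"
proof -
  have "ennreal s = ennreal (s / 2) + ennreal (s / 2)"
    using \<open>0 \<le> s\<close> by (simp flip: ennreal_plus)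
  then have "{x \<in> space M. ennreal s < u x + v x}
      \<subseteq> {x \<in> space M. ennreal (s / 2) < u x} \<union> {x \<in> space M. ennreal (s / 2) < v x}"
    by (simp add: subset_iff) (meson add_mono not_less)
  then have "distribution M (\<lambda>x. u x + v x) s
      \<le> emeasure M ({x \<in> space M. ennreal (s / 2) < u x} \<union> {x \<in> space M. ennreal (s / 2) < v x})"
    unfolding distribution_def by (rule emeasure_mono) measurable
  also have "\<dots> \<le> distribution M u (s / 2) + distribution M v (s / 2)"
    unfolding distribution_def by (rule emeasure_subadditive) measurable
  finally show ?thesis .
qed

lemma distribution_cmult:
  assumes "0 < a"
  shows "distribution M (\<lambda>x. ennreal a * u x) s = distribution M u (s / a)"
proof -
  \<comment> \<open>Negative s is covered too: \<open>ennreal\<close> sends s and s/a to 0, and both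
    sides then say that y is positive.\<close>
  have "ennreal s < ennreal a * y \<longleftrightarrow> ennreal (s / a) < y" for y
  proof (cases y)
    case (real r)
    then show ?thesis using assms
      by (cases "0 \<le> s") (auto simp: ennreal_mult[symmetric] ennreal_less_iff field_simps
          ennreal_neg divide_nonpos_pos zero_less_mult_iff)
  next
    case top
    then show ?thesis using assms by (simp add: ennreal_mult_top)
  qed
  then show ?thesis by (simp add: distribution_def)
qed

text \<open>A strict inequality s < sup of \<open>U n x\<close> is already reached at some n, so the
  indicator of the levels above s commutes with increasing limits. Monotone convergence does the
  rest.\<close>

lemma distribution_tendsto:
  assumes [measurable]: "\<And>n. U n \<in> borel_measurable M" "u \<in> borel_measurable M"
    and lim: "AE x in M. incseq (\<lambda>n. U n x) \<and> (\<lambda>n. U n x) \<longlonglongrightarrow> u x"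
  shows "(\<lambda>n. distribution M (U n) s) \<longlonglongrightarrow> distribution M u s"
proof -
  have AE_mono: "AE x in M. indicator {ennreal s<..} (U n x)
      \<le> (indicator {ennreal s<..} (U (Suc n) x) :: ennreal)" for n
    using lim by eventually_elim (auto split: split_indicator dest: incseq_SucD less_le_trans)
  have "(\<integral>\<^sup>+x. indicator {ennreal s<..} (u x) \<partial>M)
      = (\<integral>\<^sup>+x. (SUP n. indicator {ennreal s<..} (U n x)) \<partial>M)"
  proof (rule nn_integral_cong_AE)
    show "AE x in M. indicator {ennreal s<..} (u x)
        = (SUP n. indicator {ennreal s<..} (U n x) :: ennreal)"
      using lim
    proof eventually_elim
      case (elim x)
      then have u: "u x = (SUP n. U n x)" using LIMSEQ_SUP LIMSEQ_unique by blast
      show ?case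
      proof (cases "ennreal s < u x")
        case True
        then obtain n where "ennreal s < U n x" unfolding u less_SUP_iff by blast
        then have "(1::ennreal) \<le> (SUP n. indicator {ennreal s<..} (U n x))"
          by (intro SUP_upper2[of n]) auto
        moreover have "(SUP n. indicator {ennreal s<..} (U n x)) \<le> (1::ennreal)"
          by (intro SUP_least) (auto split: split_indicator)
        ultimately show ?thesis using True by auto
      next
        case False
        then have "\<not> ennreal s < U n x" for n unfolding u less_SUP_iff by blast
        with False show ?thesis by simp
      qed
    qed
  qed
  also have "\<dots> = (SUP n. \<integral>\<^sup>+x. indicator {ennreal s<..} (U n x) \<partial>M)"
    by (rule nn_integral_monotone_convergence_SUP_AE) (use AE_mono in auto)
  finally have "distribution M u s = (SUP n. distribution M (U n) s)"
    by (simp add: distribution_eq_nn_integral)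
  moreover have "incseq (\<lambda>n. distribution M (U n) s)"
    using lim by (intro incseq_SucI distribution_mono_AE) (auto dest: incseq_SucD elim!: eventually_mono)
  ultimately show ?thesis using LIMSEQ_SUP by metis
qed

text \<open>This is right continuity of the distribution function: the set where u exceeds s is the
  increasing union of the sets where u exceeds s + 1/(n+1).\<close>

lemma distribution_le_if_greater:
  assumes [measurable]: "u \<in> borel_measurable M" and "0 \<le> s"
    and le: "\<And>s'. s < s' \<Longrightarrow> distribution M u s' \<le> t"
  shows "distribution M u s \<le> t"
proof -
  let ?A = "\<lambda>n. {x \<in> space M. ennreal (s + 1 / real (Suc n)) < u x}"
  have "{x \<in> space M. ennreal s < u x} = (\<Union>n. ?A n)"
  proof safe
    fix x assume x: "x \<in> space M" "ennreal s < u x"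
    \<comment> \<open>Since \<open>u x\<close> may be infinite, a finite level r strictly between is
      chosen first, so that the gap r - s is a positive real.\<close>
    then obtain r where r: "ennreal s < ennreal r" "ennreal r < u x"
      by (metis ennreal_cases dense order_less_imp_not_less top.not_eq_extremum)
    then have "s < r" using \<open>0 \<le> s\<close> by (simp add: ennreal_less_iff)
    then obtain n where "1 / real (Suc n) < r - s"
      using nat_approx_posE[of "r - s"] by auto
    then have "ennreal (s + 1 / real (Suc n)) \<le> ennreal r" by (intro ennreal_leI) simp
    with x r show "x \<in> (\<Union>n. ?A n)" by (auto intro: le_less_trans)
  next
    fix x n assume "ennreal (s + 1 / real (Suc n)) < u x"
    then show "ennreal s < u x" by (rule le_less_trans[rotated]) (simp add: ennreal_leI)
  qed
  moreover have "incseq ?A"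
    by (rule incseq_SucI) (auto elim!: le_less_trans[rotated] intro!: ennreal_leI simp: frac_le)
  ultimately have "distribution M u s = (SUP n. distribution M u (s + 1 / real (Suc n)))"
    unfolding distribution_def by (subst SUP_emeasure_incseq) auto
  also have "\<dots> \<le> t" by (intro SUP_least le) simp
  finally show ?thesis .
qed

section \<open>Layer cake formula and dependence on the distribution function alone\<close>

text \<open>This evaluates the inner integral of the layer cake formula. In the infinite case the
  intervals (0,r) force the measure above every real r.\<close>

lemma emeasure_lborel_Ioo_ennreal: "emeasure lborel {s. 0 < s \<and> ennreal s < a} = a"
proof (cases a)
  case (real r)
  then have "{s. 0 < s \<and> ennreal s < a} = {0<..<r}" by (auto simp: ennreal_less_iff)
  with real show ?thesis by simp
next
  case top
  have "ennreal r \<le> emeasure lborel {0::real<..}" if "0 \<le> r" for r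
    using emeasure_mono[of "{0<..<r}" "{0<..}" lborel] that
    by (simp add: subset_iff)
  then have "emeasure lborel {0::real<..} = \<infinity>"
    by (metis ennreal_cases ennreal_le_iff gt_ex infinity_ennreal_def le_less_trans less_le_not_le less_imp_le)
  moreover have "{s. 0 < s \<and> ennreal s < a} = {0<..}" using top by auto
  ultimately show ?thesis using top by simp
qed

text \<open>The region 0 < s < \<open>u x\<close> is measured in both orders: slicing along s gives
  \<open>u x\<close>, slicing along x gives \<open>distribution M u s\<close>.\<close>

lemma (in sigma_finite_measure) nn_integral_layer_cake:
  assumes [measurable]: "u \<in> borel_measurable M"
  shows "(\<integral>\<^sup>+x. u x \<partial>M) = (\<integral>\<^sup>+s\<in>{0<..}. distribution M u s \<partial>lborel)"
proof -
  interpret pair_sigma_finite M lborel ..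
  let ?h = "\<lambda>x s. indicator {s. 0 < s \<and> ennreal s < u x} s :: ennreal"
  have "(\<integral>\<^sup>+x. u x \<partial>M) = (\<integral>\<^sup>+x. (\<integral>\<^sup>+s. ?h x s \<partial>lborel) \<partial>M)"
    by (simp add: emeasure_lborel_Ioo_ennreal)
  also have "\<dots> = (\<integral>\<^sup>+s. (\<integral>\<^sup>+x. ?h x s \<partial>M) \<partial>lborel)"
    by (rule Fubini'[symmetric]) measurable
  also have "\<dots> = (\<integral>\<^sup>+s\<in>{0<..}. distribution M u s \<partial>lborel)"
    unfolding distribution_eq_nn_integral[OF assms]
    by (intro nn_integral_cong) (auto split: split_indicator intro!: nn_integral_cong)
  finally show ?thesis .
qed

lemma (in sigma_finite_measure) half_norm_cong_distribution:
  assumes "u \<in> borel_measurable M" "v \<in> borel_measurable M"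
    and eq: "\<And>s. 0 < s \<Longrightarrow> distribution M u s = distribution M v s"
  shows "half_norm M u = half_norm M v"
proof -
  have "(\<integral>\<^sup>+s\<in>{0<..}. distribution M u s \<partial>lborel) = (\<integral>\<^sup>+s\<in>{0<..}. distribution M v s \<partial>lborel)"
    using eq by (intro nn_integral_cong) (auto split: split_indicator)
  moreover have "weak_half_norm M u = weak_half_norm M v"
    unfolding weak_half_norm_def using eq by (intro SUP_cong) auto
  ultimately show ?thesis
    using assms by (simp add: half_norm_def nn_integral_layer_cake)
qed

section \<open>Quasi-norm axioms\<close>

lemma half_norm_mono_AE:
  assumes "u \<in> borel_measurable M" "v \<in> borel_measurable M" "AE x in M. u x \<le> v x"
  shows "half_norm M u \<le> half_norm M v"
  unfolding half_norm_def weak_half_norm_def using assms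
  by (intro add_mono nn_integral_mono_AE SUP_mono' mult_left_mono power_mono distribution_mono_AE) auto

text \<open>For a > 0 the substitution of a * s for s permutes the positive levels and pulls a
  factor a out of the supremum. The case a = 0 is separate because \<open>distribution_cmult\<close>
  divides by a.\<close>

lemma half_norm_cmult:
  assumes [measurable]: "u \<in> borel_measurable M" and "0 \<le> a"
  shows "half_norm M (\<lambda>x. ennreal a * u x) = ennreal a * half_norm M u"
proof (cases "a = 0")
  case True
  then show ?thesis by (simp add: half_norm_def weak_half_norm_def distribution_def)
next
  case False
  with \<open>0 \<le> a\<close> have "0 < a" by simp
  have "weak_half_norm M (\<lambda>x. ennreal a * u x)
      = (SUP s\<in>(\<lambda>s. a * s) ` {0<..}. ennreal s * (distribution M u (s / a))\<^sup>2)"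
  proof -
    have "(\<lambda>s. a * s) ` {0<..} = {0<..}"
    proof safe
      fix s :: real assume "0 < s"
      then show "s \<in> (\<lambda>s. a * s) ` {0<..}"
        using \<open>0 < a\<close> by (intro image_eqI[of _ _ "s / a"]) auto
    qed (use \<open>0 < a\<close> in auto)
    then show ?thesis by (simp add: weak_half_norm_def distribution_cmult[OF \<open>0 < a\<close>])
  qed
  also have "\<dots> = (SUP s\<in>{0<..}. ennreal a * (ennreal s * (distribution M u s)\<^sup>2))"
    unfolding image_image using \<open>0 < a\<close> by (intro SUP_cong) (auto simp: ennreal_mult mult.assoc)
  also have "\<dots> = ennreal a * weak_half_norm M u"
    by (simp add: weak_half_norm_def SUP_mult_left_ennreal)
  finally show ?thesis by (simp add: half_norm_def nn_integral_cmult distrib_left)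
qed

text \<open>The integral summand detects functions that are not almost everywhere 0; the converse
  compares u with the zero function by monotonicity.\<close>

lemma half_norm_eq_0_iff:
  assumes [measurable]: "u \<in> borel_measurable M"
  shows "half_norm M u = 0 \<longleftrightarrow> (AE x in M. u x = 0)"
proof
  assume "half_norm M u = 0"
  then show "AE x in M. u x = 0" by (simp add: half_norm_def nn_integral_0_iff_AE)
next
  assume u: "AE x in M. u x = 0"
  have "half_norm M u \<le> half_norm M (\<lambda>x. 0)"
    using u by (intro half_norm_mono_AE) auto
  then show "half_norm M u = 0"
    by (simp add: half_norm_def weak_half_norm_def distribution_def)
qed

text \<open>The bound of a + b by twice the maximum avoids the square of a difference, at the price
  of 4 in place of the sharp constant 2.\<close>

lemma power2_add_le_ennreal: "(a + b)\<^sup>2 \<le> 4 * a\<^sup>2 + 4 * (b::ennreal)\<^sup>2"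
proof -
  have "(a + b)\<^sup>2 \<le> (2 * max a b)\<^sup>2"
    by (intro power_mono) (auto simp: mult_2 intro: add_mono)
  also have "\<dots> \<le> 4 * a\<^sup>2 + 4 * b\<^sup>2"
    by (auto simp: power_mult_distrib max_def)
  finally show ?thesis .
qed

text \<open>The constant is 8 = 2 * 4: the factor 2 comes from halving the level, the factor 4 from
  squaring a sum. The integral summand is additive and is merely weakened to the same
  constant.\<close>

lemma half_norm_add_le:
  assumes [measurable]: "u \<in> borel_measurable M" "v \<in> borel_measurable M"
  shows "half_norm M (\<lambda>x. u x + v x) \<le> 8 * (half_norm M u + half_norm M v)"
proof -
  have half: "ennreal s * (4 * (distribution M w (s / 2))\<^sup>2) \<le> 8 * weak_half_norm M w"
    if "0 < s" for s w
  proof -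
    have "ennreal s * 4 = 8 * ennreal (s / 2)"
      using \<open>0 < s\<close> ennreal_mult[of s 4] ennreal_mult[of 8 "s / 2"] by (simp add: mult.commute)
    then have "ennreal s * (4 * (distribution M w (s / 2))\<^sup>2)
        = 8 * (ennreal (s / 2) * (distribution M w (s / 2))\<^sup>2)"
      by (metis mult.assoc)
    also have "\<dots> \<le> 8 * weak_half_norm M w"
      unfolding weak_half_norm_def using \<open>0 < s\<close> by (intro mult_left_mono SUP_upper) auto
    finally show ?thesis .
  qed
  have "weak_half_norm M (\<lambda>x. u x + v x) \<le> 8 * weak_half_norm M u + 8 * weak_half_norm M v"
    unfolding weak_half_norm_def[of M "\<lambda>x. u x + v x"]
  proof (rule SUP_least)
    fix s :: real assume "s \<in> {0<..}"
    then have "0 < s" by simp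
    have "ennreal s * (distribution M (\<lambda>x. u x + v x) s)\<^sup>2
        \<le> ennreal s * (distribution M u (s / 2) + distribution M v (s / 2))\<^sup>2"
      using \<open>0 < s\<close> by (intro mult_left_mono power_mono distribution_add_le) auto
    also have "\<dots> \<le> ennreal s * (4 * (distribution M u (s / 2))\<^sup>2 + 4 * (distribution M v (s / 2))\<^sup>2)"
      by (intro mult_left_mono power2_add_le_ennreal) auto
    also have "\<dots> \<le> 8 * weak_half_norm M u + 8 * weak_half_norm M v"
      unfolding distrib_left using \<open>0 < s\<close> by (intro add_mono half)
    finally show "ennreal s * (distribution M (\<lambda>x. u x + v x) s)\<^sup>2
        \<le> 8 * weak_half_norm M u + 8 * weak_half_norm M v" .
  qed
  moreover have "(\<integral>\<^sup>+x. u x + v x \<partial>M) \<le> 8 * (\<integral>\<^sup>+x. u x \<partial>M) + 8 * (\<integral>\<^sup>+x. v x \<partial>M)"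
    using mult_right_mono[of 1 "8::ennreal"]
    by (subst nn_integral_add) (auto intro!: add_mono)
  ultimately show ?thesis
    unfolding half_norm_def distrib_left by (auto intro: order_trans[OF add_mono] simp: ac_simps)
qed

lemma half_norm_incseq:
  assumes "\<And>n. U n \<in> borel_measurable M"
    and lim: "AE x in M. incseq (\<lambda>n. U n x) \<and> (\<lambda>n. U n x) \<longlonglongrightarrow> u x"
  shows "incseq (\<lambda>n. half_norm M (U n))"
  using assms
  by (intro incseq_SucI half_norm_mono_AE) (auto dest: incseq_SucD elim!: eventually_mono)

text \<open>Monotone convergence handles the integral. For the weak part the limit is taken at each
  fixed level s, where the terms are bounded by the supremum of the weak quasi-norms; the supremum
  over s comes last.\<close>

lemma half_norm_tendsto:
  assumes [measurable]: "\<And>n. U n \<in> borel_measurable M" "u \<in> borel_measurable M"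
    and lim: "AE x in M. incseq (\<lambda>n. U n x) \<and> (\<lambda>n. U n x) \<longlonglongrightarrow> u x"
  shows "(\<lambda>n. half_norm M (U n)) \<longlonglongrightarrow> half_norm M u"
proof -
  have mono: "AE x in M. U n x \<le> U (Suc n) x" for n
    using lim by (auto dest: incseq_SucD elim!: eventually_mono)
  have le: "AE x in M. U n x \<le> u x" for n
    using lim by eventually_elim (auto intro: incseq_le)
  have "(\<integral>\<^sup>+x. u x \<partial>M) = (\<integral>\<^sup>+x. (SUP n. U n x) \<partial>M)"
    by (intro nn_integral_cong_AE, use lim in eventually_elim)
      (auto intro: LIMSEQ_unique[OF _ LIMSEQ_SUP])
  also have "\<dots> = (SUP n. \<integral>\<^sup>+x. U n x \<partial>M)"
    using mono by (intro nn_integral_monotone_convergence_SUP_AE) auto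
  finally have int: "(\<integral>\<^sup>+x. u x \<partial>M) = (SUP n. \<integral>\<^sup>+x. U n x \<partial>M)" .
  have "weak_half_norm M u \<le> (SUP n. weak_half_norm M (U n))"
    unfolding weak_half_norm_def[of M u]
  proof (rule SUP_least)
    fix s :: real assume "s \<in> {0<..}"
    then have "0 < s" by simp
    note d = distribution_tendsto[OF assms, of s]
    have "(\<lambda>n. (distribution M (U n) s)\<^sup>2) \<longlonglongrightarrow> (distribution M u s)\<^sup>2"
      \<comment> \<open>Both factors have the same limit, so the product of the limits is never 0
        times infinity.\<close>
      unfolding power2_eq_square by (rule tendsto_mult_ennreal[OF d d]) auto
    then have "(\<lambda>n. ennreal s * (distribution M (U n) s)\<^sup>2)
        \<longlonglongrightarrow> ennreal s * (distribution M u s)\<^sup>2"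
      by (rule ennreal_tendsto_cmult[rotated]) simp
    moreover have "ennreal s * (distribution M (U n) s)\<^sup>2 \<le> (SUP n. weak_half_norm M (U n))" for n
      unfolding weak_half_norm_def using \<open>0 < s\<close>
      by (intro SUP_upper2[of n UNIV] SUP_upper2[of s "{0<..}"]) auto
    ultimately show "ennreal s * (distribution M u s)\<^sup>2 \<le> (SUP n. weak_half_norm M (U n))"
      by (intro LIMSEQ_le_const2) auto
  qed
  moreover have "incseq (\<lambda>n. \<integral>\<^sup>+x. U n x \<partial>M)"
    using mono by (intro incseq_SucI nn_integral_mono_AE)
  moreover have "incseq (\<lambda>n. weak_half_norm M (U n))"
    unfolding weak_half_norm_def using mono
    by (intro incseq_SucI SUP_mono' mult_left_mono power_mono distribution_mono_AE) auto
  \<comment> \<open>Both summands increase in n, so the supremum of their sum is the sum of their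
    suprema.\<close>
  ultimately have "half_norm M u \<le> (SUP n. half_norm M (U n))"
    unfolding half_norm_def int by (subst ennreal_SUP_add) (auto intro: add_left_mono)
  moreover have "(SUP n. half_norm M (U n)) \<le> half_norm M u"
    using le by (intro SUP_least half_norm_mono_AE) auto
  ultimately have "half_norm M u = (SUP n. half_norm M (U n))" by (rule antisym)
  then show ?thesis
    using LIMSEQ_SUP half_norm_incseq[of U M u] assms by metis
qed

section \<open>Values on indicator functions\<close>

lemma distribution_cmult_indicator:
  assumes "E \<in> sets M" "0 \<le> s"
  shows "distribution M (\<lambda>x. ennreal c * indicator E x) s = (if s < c then emeasure M E else 0)"
proof -
  have "{x \<in> space M. ennreal s < ennreal c * indicator E x} = (if s < c then E else {})"
    using assms sets.sets_into_space[of E M]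
    by (auto simp: ennreal_less_iff split: split_indicator_asm)
  then show ?thesis by (simp add: distribution_def)
qed

lemma half_norm_indicator:
  assumes "E \<in> sets M"
  shows "half_norm M (indicator E) = emeasure M E + (emeasure M E)\<^sup>2"
proof -
  have d: "distribution M (indicator E) s = (if s < 1 then emeasure M E else 0)" if "0 < s" for s
    using distribution_cmult_indicator[of E M s 1] assms that by simp
  have "weak_half_norm M (indicator E) \<le> (emeasure M E)\<^sup>2"
    unfolding weak_half_norm_def
    using mult_right_mono[of "ennreal _" 1 "(emeasure M E)\<^sup>2"]
    by (intro SUP_least) (auto simp: d)
  moreover have "(emeasure M E)\<^sup>2 \<le> weak_half_norm M (indicator E)"
  proof (rule LIMSEQ_le_const2)
    \<comment> \<open>The distribution function drops to 0 at level 1, so the value is approached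
      through levels below 1. The denominator n + 2 keeps these levels positive, as the supremum
      ranges over s > 0.\<close>
    have "(\<lambda>n. ennreal (1 - 1 / real (Suc (Suc n)))) \<longlonglongrightarrow> ennreal (1 - 0)"
      by (intro tendsto_intros LIMSEQ_Suc lim_inverse_n'[THEN LIMSEQ_Suc])
    then show "(\<lambda>n. ennreal (1 - 1 / real (Suc (Suc n))) * (emeasure M E)\<^sup>2) \<longlonglongrightarrow> (emeasure M E)\<^sup>2"
      using tendsto_mult_ennreal[OF _ tendsto_const] by fastforce
    have "ennreal (1 - 1 / real (Suc (Suc n))) * (emeasure M E)\<^sup>2
        \<le> weak_half_norm M (indicator E)" for n
      unfolding weak_half_norm_def
      by (intro SUP_upper2[of "1 - 1 / real (Suc (Suc n))"]) (auto simp: d)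
    then show "\<exists>N. \<forall>n\<ge>N. ennreal (1 - 1 / real (Suc (Suc n))) * (emeasure M E)\<^sup>2
        \<le> weak_half_norm M (indicator E)"
      by blast
  qed
  ultimately show ?thesis using assms by (simp add: half_norm_def)
qed

section \<open>The rearrangement determines the distribution function\<close>

text \<open>The rearrangement is a generalized inverse of the distribution function. Right
  continuity of the latter makes the infimum attained, which yields an equivalence with non-strict
  inequalities.\<close>

lemma rearrangement_le_iff:
  assumes "f \<in> Mfun" "0 \<le> s"
  shows "rearrangement f t \<le> ennreal s \<longleftrightarrow> distribution leb_pos (abs_fun f) s \<le> ennreal t"
proof
  have [measurable]: "abs_fun f \<in> borel_measurable leb_pos"
    using abs_fun_Mplus[OF assms(1)] by (simp add: Mplus_def)
  have r: "rearrangement f t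
      = Inf (ennreal ` {s. 0 \<le> s \<and> distribution leb_pos (abs_fun f) s \<le> ennreal t})"
    by (simp add: rearrangement_def distribution_def abs_fun_def)
  show "rearrangement f t \<le> ennreal s" if "distribution leb_pos (abs_fun f) s \<le> ennreal t"
    unfolding r using that assms(2) by (intro Inf_lower) auto
  show "distribution leb_pos (abs_fun f) s \<le> ennreal t" if le: "rearrangement f t \<le> ennreal s"
  proof (rule distribution_le_if_greater)
    fix s' assume "s < s'"
    with le \<open>0 \<le> s\<close> have "rearrangement f t < ennreal s'"
      by (metis ennreal_less_iff le_less_trans)
    then obtain q where q: "0 \<le> q" "distribution leb_pos (abs_fun f) q \<le> ennreal t"
        "ennreal q < ennreal s'"
      unfolding r Inf_less_iff by auto
    then have "distribution leb_pos (abs_fun f) s' \<le> distribution leb_pos (abs_fun f) q"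
      by (intro distribution_antimono) (auto simp: ennreal_less_iff)
    with q show "distribution leb_pos (abs_fun f) s' \<le> ennreal t" by simp
  qed (use assms in auto)
qed

text \<open>An extended non-negative number is the infimum of its finite upper bounds; infinity is
  the one that has none.\<close>

lemma ennreal_eqI_le_real:
  assumes "\<And>s. 0 \<le> s \<Longrightarrow> x \<le> ennreal s \<longleftrightarrow> y \<le> ennreal s"
  shows "x = y"
proof (rule antisym)
  show "x \<le> y" by (cases y) (use assms in auto)
  show "y \<le> x" by (cases x) (use assms in auto)
qed

lemma distribution_eq_if_rearrangement_eq:
  assumes "f \<in> Mfun" "g \<in> Mfun" "0 \<le> s"
    and eq: "\<And>t. 0 < t \<Longrightarrow> rearrangement f t = rearrangement g t"
  shows "distribution leb_pos (abs_fun f) s = distribution leb_pos (abs_fun g) s"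
proof -
  let ?d = "\<lambda>f. distribution leb_pos (abs_fun f) s"
  have iff: "?d f \<le> ennreal t \<longleftrightarrow> ?d g \<le> ennreal t" if "0 < t" for t
    using assms that by (simp flip: rearrangement_le_iff)
  \<comment> \<open>The rearrangements are compared only at t > 0, so the bound 0 is recovered as
    the limit of the positive bounds.\<close>
  have "a \<le> ennreal 0 \<longleftrightarrow> (\<forall>t>0. a \<le> ennreal t)" for a
    using ennreal_le_epsilon[of 0 a] by (auto intro: order_trans)
  with iff have "?d f \<le> ennreal t \<longleftrightarrow> ?d g \<le> ennreal t" if "0 \<le> t" for t
    using that by (cases "t = 0") auto
  then show ?thesis by (rule ennreal_eqI_le_real)
qed

section \<open>The half-line and its step functions\<close>

text \<open>A countable cover by sets of finite measure keeps this property in the completion.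
  Lebesgue measure is the completion of \<open>lborel\<close>, and the layer cake formula on
  \<open>leb_pos\<close> needs sigma-finiteness.\<close>

lemma sigma_finite_completion:
  assumes "sigma_finite_measure M"
  shows "sigma_finite_measure (completion M)"
proof -
  interpret sigma_finite_measure M by fact
  obtain A where "countable A" "A \<subseteq> sets M" "\<Union>A = space M" "\<forall>a\<in>A. emeasure M a \<noteq> \<infinity>"
    using sigma_finite_countable by auto
  then show ?thesis
    by (intro sigma_finite_measure.intro exI[of _ A]) (auto simp: subset_iff)
qed

lemma emeasure_leb_pos_Ioo: "0 \<le> a \<Longrightarrow> emeasure leb_pos {0<..<a} = ennreal a"
  by (subst emeasure_restrict_space) auto

lemma sets_leb_pos_Ioo: "{0<..<a} \<in> sets leb_pos"
  by (auto simp: sets_restrict_space_iff)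

lemma step_Mplus: "(\<lambda>x. ennreal c * indicator {0<..<a} x) \<in> Mplus"
  using sets_leb_pos_Ioo[of a] unfolding Mplus_def by measurable

text \<open>Below level c the distribution function is a, and for t > 0 the condition a \<le> t says
  precisely that t lies outside the open interval (0,a); from level c on it is 0.\<close>

lemma rearrangement_step:
  assumes "0 \<le> c" "0 < a" "0 < t"
  shows "rearrangement (lift_fun (\<lambda>x. ennreal c * indicator {0<..<a} x)) t
    = ennreal c * indicator {0<..<a} t"
proof (rule ennreal_eqI_le_real)
  fix s :: real assume "0 \<le> s"
  then show "rearrangement (lift_fun (\<lambda>x. ennreal c * indicator {0<..<a} x)) t \<le> ennreal s
      \<longleftrightarrow> ennreal c * indicator {0<..<a} t \<le> ennreal s"
    using assms
    by (auto simp: rearrangement_le_iff lift_fun_Mfun_iff step_Mplus distribution_cmult_indicator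
        sets_leb_pos_Ioo emeasure_leb_pos_Ioo split: split_indicator)
qed

lemma integral_rearrangement_step:
  assumes "0 \<le> c" "0 < a" "0 < t"
  shows "(\<integral>\<^sup>+s\<in>{0<..<t}. rearrangement (lift_fun (\<lambda>x. ennreal c * indicator {0<..<a} x)) s \<partial>leb_pos)
    = ennreal (c * min a t)"
proof -
  have "(\<integral>\<^sup>+s\<in>{0<..<t}. rearrangement (lift_fun (\<lambda>x. ennreal c * indicator {0<..<a} x)) s \<partial>leb_pos)
      = (\<integral>\<^sup>+s. ennreal c * indicator {0<..<min a t} s \<partial>leb_pos)"
    using assms by (intro nn_integral_cong) (auto simp: rearrangement_step split: split_indicator)
  also have "\<dots> = ennreal (c * min a t)"
    using assms by (simp add: nn_integral_cmult_indicator sets_leb_pos_Ioo emeasure_leb_pos_Ioo ennreal_mult)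
  finally show ?thesis .
qed

lemma half_norm_step:
  assumes "0 \<le> c" "0 < a"
  shows "half_norm leb_pos (\<lambda>x. ennreal c * indicator {0<..<a} x) = ennreal (c * (a + a\<^sup>2))"
  using assms
  by (subst half_norm_cmult)
    (auto simp: sets_leb_pos_Ioo half_norm_indicator emeasure_leb_pos_Ioo ennreal_power ennreal_mult
      intro!: borel_measurable_indicator)

section \<open>Verification of the required properties and the counterexample\<close>

theorem corollary5p10:
  shows "\<exists>N :: (real \<Rightarrow> ecomplex) \<Rightarrow> ennreal.
    quasi_Banach_function_norm N \<and> rearrangement_invariant N \<and> axiom_P5 N \<and> \<not> HLP_principle N"
proof (intro exI conjI)
  let ?N = "\<lambda>f. half_norm leb_pos (abs_fun f)"
  interpret sigma_finite_measure leb_pos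
    by (intro sigma_finite_measure_restrict_space sigma_finite_completion sigma_finite_lborel) simp
  have "axiom_Q1 ?N"
    unfolding axiom_Q1_def Mplus_def abs_lift_fun
    by (intro conjI allI impI ballI half_norm_cmult half_norm_eq_0_iff exI[of _ 8])
      (auto intro: half_norm_add_le[unfolded distrib_left] simp: distrib_left)
  moreover have "axiom_P2 ?N"
    unfolding axiom_P2_def Mplus_def abs_lift_fun by (auto intro: half_norm_mono_AE)
  moreover have "axiom_P3 ?N"
    unfolding axiom_P3_def Mplus_def abs_lift_fun
    by (intro allI impI conjI; elim conjE) (blast intro: half_norm_incseq half_norm_tendsto)+
  moreover have "axiom_P4 ?N"
    unfolding axiom_P4_def abs_lift_fun
    by (auto simp: half_norm_indicator power2_eq_square ennreal_mult_less_top)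
  \<comment> \<open>Equality almost everywhere gives inequality almost everywhere in both
    directions.\<close>
  moreover have "?N f = ?N g" if "f \<in> Mfun" "g \<in> Mfun" "AE x in leb_pos. f x = g x" for f g
    using abs_fun_Mplus[OF that(1)] abs_fun_Mplus[OF that(2)] that(3)
    by (intro antisym half_norm_mono_AE) (auto simp: Mplus_def abs_fun_def elim!: eventually_mono)
  ultimately show "quasi_Banach_function_norm ?N"
    unfolding quasi_Banach_function_norm_def abs_lift_fun by blast
  show "rearrangement_invariant ?N"
    unfolding rearrangement_invariant_def
  proof (intro ballI impI half_norm_cong_distribution)
    fix f g assume fg: "f \<in> Mfun" "g \<in> Mfun"
    then show "abs_fun f \<in> borel_measurable leb_pos" "abs_fun g \<in> borel_measurable leb_pos"
      by (simp_all add: abs_fun_Mplus flip: Mplus_def)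
    fix s :: real
    assume "0 < s" "\<forall>t>0. rearrangement f t = rearrangement g t"
    with fg show "distribution leb_pos (abs_fun f) s = distribution leb_pos (abs_fun g) s"
      by (intro distribution_eq_if_rearrangement_eq) auto
  qed
  \<comment> \<open>The integral summand dominates the integral over each E, which gives (P5) with
    constant 1.\<close>
  have "(\<integral>\<^sup>+x\<in>E. u x \<partial>leb_pos) \<le> 1 * half_norm leb_pos u" for E u
  proof -
    have "(\<integral>\<^sup>+x\<in>E. u x \<partial>leb_pos) \<le> (\<integral>\<^sup>+x. u x \<partial>leb_pos)"
      by (intro nn_integral_mono) (auto split: split_indicator)
    also have "\<dots> \<le> 1 * half_norm leb_pos u" by (simp add: half_norm_def)
    finally show ?thesis .
  qed
  then show "axiom_P5 ?N"
    unfolding axiom_P5_def abs_lift_fun by (intro ballI impI exI[of _ 1]) auto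
  show "\<not> HLP_principle ?N"
  proof
    let ?f = "\<lambda>x::real. ennreal (1 / 2) * indicator {0<..<2} x"
    let ?g = "\<lambda>x::real. ennreal 1 * indicator {0<..<1} x"
    \<comment> \<open>The two integrals are min(2,t)/2 and min(1,t); they agree from t = 2
      on.\<close>
    have "(\<integral>\<^sup>+s\<in>{0<..<t}. rearrangement (lift_fun ?f) s \<partial>leb_pos)
        \<le> (\<integral>\<^sup>+s\<in>{0<..<t}. rearrangement (lift_fun ?g) s \<partial>leb_pos)" if "0 < t" for t
      using that by (subst (1 2) integral_rearrangement_step) (auto intro!: ennreal_leI)
    moreover assume "HLP_principle ?N"
    moreover have "lift_fun ?f \<in> Mfun" "lift_fun ?g \<in> Mfun"
      by (simp_all only: lift_fun_Mfun_iff step_Mplus)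
    ultimately have "?N (lift_fun ?f) \<le> ?N (lift_fun ?g)"
      unfolding HLP_principle_def by blast
    \<comment> \<open>The two sides are 3 and 2.\<close>
    then have "ennreal (1 / 2 * (2 + 2\<^sup>2)) \<le> ennreal (1 * (1 + 1\<^sup>2))"
      unfolding abs_lift_fun by (subst (asm) (1 2) half_norm_step) auto
    then show False by (simp del: ennreal_numeral)
  qed
qed

end
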